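(* Let $X$ be a normed real linear space, let $\Omega$ be an open subset of $X$, let $n\geq 1$ and $m\geq 0$ be integers, and let $\{f_i : 0\leq i\leq n+m\}$ be a family of continuously differentiable functions from $\Omega$ to $\mathbb{R}$. Let $x^{\ast}\in\Omega$ be a solution of the constrained minimization problem \[ \left\{ \begin{array}{ll} \text{minimize} & f_0(x) \\ \text{subject to} & f_i(x)=0,\quad 1\leq i\leq n, \\ & f_i(x)\leq 0,\quad n+1\leq i\leq n+m, \end{array} \right. \] such that the family $\{f_i^{\prime}(x^{\ast}) : i\in J(x^{\ast})\}$ is linearly independent in $X^{\ast}$, where \[ J(x^{\ast})=\{i : 1\leq i\leq n+m \text{ and } f_i(x^{\ast})=0\}. \] Then there exist $(\lambda_1,\dots,\lambda_n)\in\mathbb{R}^n$ and $(\mu_1,\dots,\mu_m)\in [0,+\infty)^m$ such that \[ f_0^{\prime}(x^{\ast})+\sum_{i=1}^{n}\lambda_i f_i^{\prime}(x^{\ast})+\sum_{j=1}^{m}\mu_j f_{j+n}^{\prime}(x^{\ast})=0 \] and \[ \mu_j f_{j+n}(x^{\ast})=0 \quad \text{for all } 1\leq j\leq m. \]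
   Context: $X^{\ast}$ denotes the dual space of $X$, i.e. the space of continuous linear maps from $X$ to $\mathbb{R}$. The space $X$ is not assumed complete or finite dimensional. Differentiability is in the Fréchet sense, and $f_i^{\prime}(x)\in X^{\ast}$ denotes the derivative of $f_i$ at $x$. That $x^{\ast}$ is a solution of the minimization problem means: $x^{\ast}\in\Omega$ satisfies all the constraints, and $f_0(x^{\ast})\leq f_0(x)$ for every $x\in\Omega$ satisfying all the constraints. When $m=0$ there are no inequality constraints and no multipliers $\mu_j$. *)

theory Defs
  imports "HOL-Analysis.Analysis"
begin

(* HOL functions are total, so a function on an open set Omega is a total function whose values
   outside Omega are ignored; derivatives at points of Omega do not depend on them. *)

(* The derivative as an element of the normed dual space; meaningful only where f is
   differentiable. *)
definition fderiv :: "('a::real_normed_vector \<Rightarrow> real) \<Rightarrow> 'a \<Rightarrow> ('a \<Rightarrow>\<^sub>L real)" where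
  "fderiv f x = Blinfun (frechet_derivative f (at x))"

lemma fderiv_works:
  assumes "f differentiable (at x)"
  shows "(f has_derivative blinfun_apply (fderiv f x)) (at x)"
proof -
  have "(f has_derivative frechet_derivative f (at x)) (at x)"
    using assms by (simp add: frechet_derivative_works)
  then show ?thesis
    by (simp add: fderiv_def bounded_linear_Blinfun_apply has_derivative_bounded_linear)
qed

lemma fderiv_eqI:
  assumes "(f has_derivative blinfun_apply g) (at x)"
  shows "fderiv f x = g"
  using frechet_derivative_at[OF assms]
  by (simp add: fderiv_def blinfun_apply_inverse flip: frechet_derivative_at[OF assms])

(* Intended for open S only. Continuity of the derivative is with respect to the operator norm. *)
definition continuously_differentiable_on ::
    "('a::real_normed_vector \<Rightarrow> real) \<Rightarrow> 'a set \<Rightarrow> bool" where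
  "continuously_differentiable_on f S \<longleftrightarrow>
     (\<forall>x\<in>S. f differentiable (at x)) \<and> continuous_on S (fderiv f)"

(* Independence of an indexed family, unlike independence of its range, excludes repeated
   members. *)
definition linearly_independent_family :: "('i \<Rightarrow> 'b::real_vector) \<Rightarrow> 'i set \<Rightarrow> bool" where
  "linearly_independent_family v I \<longleftrightarrow>
     (\<forall>T c. finite T \<longrightarrow> T \<subseteq> I \<longrightarrow> (\<Sum>i\<in>T. c i *\<^sub>R v i) = 0 \<longrightarrow> (\<forall>i\<in>T. c i = 0))"

lemma linearly_independent_family_iff:
  "linearly_independent_family v I \<longleftrightarrow> inj_on v I \<and> independent (v ` I)"
proof
  assume "linearly_independent_family v I"
  then have L: "c i = 0"
    if "finite T" "T \<subseteq> I" "(\<Sum>i\<in>T. c i *\<^sub>R v i) = 0" "i \<in> T" for T c i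
    using that unfolding linearly_independent_family_def by simp
  have inj: "inj_on v I"
  proof (rule inj_onI, rule ccontr)
    fix i j assume ij: "i \<in> I" "j \<in> I" "v i = v j" "i \<noteq> j"
    have "(\<Sum>k\<in>{i, j}. (if k = i then 1 else -1) *\<^sub>R v k) = 0"
      using ij by simp
    then have "(if i = i then 1 else -1 :: real) = 0"
      using ij by (intro L[of "{i, j}" "\<lambda>k. if k = i then 1 else -1" i]) auto
    then show False by simp
  qed
  have "u b = 0" if T: "finite T" "T \<subseteq> v ` I" "(\<Sum>w\<in>T. u w *\<^sub>R w) = 0" "b \<in> T" for T u b
  proof -
    obtain S where S: "S \<subseteq> I" "finite S" "T = v ` S"
      using T(1,2) by (metis finite_subset_image)
    have "inj_on v S" using inj S(1) by (rule inj_on_subset)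
    then have "(\<Sum>i\<in>S. u (v i) *\<^sub>R v i) = 0"
      using T(3) S(3) by (simp add: sum.reindex)
    then have "\<forall>i\<in>S. u (v i) = 0"
      using L[of S "\<lambda>i. u (v i)"] S(1,2) by simp
    then show ?thesis using T(4) S(3) by auto
  qed
  then have "independent (v ` I)"
    unfolding real_vector.dependent_explicit by blast
  with inj show "inj_on v I \<and> independent (v ` I)" ..
next
  assume R: "inj_on v I \<and> independent (v ` I)"
  show "linearly_independent_family v I"
    unfolding linearly_independent_family_def
  proof (intro allI impI ballI)
    fix T c i
    assume T: "finite T" "T \<subseteq> I" "(\<Sum>i\<in>T. c i *\<^sub>R v i) = 0" "i \<in> T"
    have inj: "inj_on v T" using R T(2) by (meson inj_on_subset)
    let ?u = "\<lambda>w. c (the_inv_into T v w)"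
    have "(\<Sum>w\<in>v ` T. ?u w *\<^sub>R w) = 0"
      using T(3) inj by (simp add: sum.reindex the_inv_into_f_f)
    moreover have "finite (v ` T)" "v ` T \<subseteq> v ` I" "v i \<in> v ` T"
      using T by auto
    ultimately have "?u (v i) = 0"
      using R by (intro real_vector.independentD[of "v ` I" "v ` T" ?u "v i"]) simp_all
    then show "c i = 0" using inj T(4) by (simp add: the_inv_into_f_f)
  qed
qed

definition feasible_set ::
    "'a set \<Rightarrow> (nat \<Rightarrow> 'a \<Rightarrow> real) \<Rightarrow> nat \<Rightarrow> nat \<Rightarrow> 'a set" where
  "feasible_set \<Omega> f n m =
     {x \<in> \<Omega>. (\<forall>i\<in>{1..n}. f i x = 0) \<and> (\<forall>i\<in>{n+1..n+m}. f i x \<le> 0)}"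

definition is_solution ::
    "'a set \<Rightarrow> (nat \<Rightarrow> 'a \<Rightarrow> real) \<Rightarrow> nat \<Rightarrow> nat \<Rightarrow> 'a \<Rightarrow> bool" where
  "is_solution \<Omega> f n m xs \<longleftrightarrow>
     xs \<in> feasible_set \<Omega> f n m \<and> (\<forall>x\<in>feasible_set \<Omega> f n m. f 0 xs \<le> f 0 x)"

definition active_set ::
    "(nat \<Rightarrow> 'a \<Rightarrow> real) \<Rightarrow> nat \<Rightarrow> nat \<Rightarrow> 'a \<Rightarrow> nat set" where
  "active_set f n m x = {i. 1 \<le> i \<and> i \<le> n + m \<and> f i x = 0}"

end

theory Submission
  imports Defs
begin

text \<open>
  Write \<open>L i\<close> for the derivative of \<open>f i\<close> at the solution \<open>x\<close>, and \<open>J\<close> for the finite set of active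
  constraints. Independence of the \<open>L i\<close>, \<open>i \<in> J\<close>, gives vectors \<open>e j\<close> with
  \<open>L i (e j) = (if i = j then 1 else 0)\<close> (\<open>exists_biorthogonal_vectors\<close>), and these vectors carry the
  whole argument.

  They first turn linearized feasible directions into feasible points. Given any direction \<open>h\<close>,
  correcting \<open>x + t h\<close> inside the span of the \<open>e j\<close> yields a point at distance \<open>o(t)\<close> from \<open>x + t h\<close>
  at which each active \<open>f i\<close> takes exactly the value \<open>t * L i h\<close> (\<open>exact_linearized_values\<close>, a
  Lyusternik-type statement). If \<open>L i h\<close> vanishes for the equality constraints and is nonpositive for
  the active inequality constraints, that point is feasible for small \<open>t > 0\<close>, and minimality gives
  \<open>L 0 h \<ge> 0\<close> (\<open>derivative_nonneg_on_feasible_directions\<close>).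

  They then make the multipliers explicit, so that neither Farkas' lemma nor a separation theorem
  enters. On the common kernel of the \<open>L j\<close> both \<open>h\<close> and \<open>- h\<close> are admissible, so \<open>L 0\<close> vanishes
  there and hence \<open>L 0 = (\<Sum>j\<in>J. L 0 (e j) * L j)\<close>. The multiplier of constraint \<open>j\<close> is therefore
  \<open>- L 0 (e j)\<close>; for an active inequality constraint the direction \<open>- e j\<close> is admissible, which makes
  this number nonnegative. Inactive constraints receive multiplier \<open>0\<close>.

  The space itself may be incomplete: the correction has only finitely many unknown coordinates, and
  these are found by a contraction argument in the dual space, which is always complete.
\<close>

section \<open>Biorthogonal vectors\<close>

text \<open>
  Subtracting \<open>\<Sum>j\<in>J. v j x * e j\<close> from \<open>x\<close> projects onto the common kernel of the \<open>v j\<close>, where \<open>g\<close>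
  vanishes.
\<close>

lemma vanishing_on_common_kernel_imp_combination:
  fixes v :: "'i \<Rightarrow> ('a::real_normed_vector \<Rightarrow>\<^sub>L real)"
  assumes "finite J"
    and bi: "\<And>i j. i \<in> J \<Longrightarrow> j \<in> J \<Longrightarrow> v i (e j) = (if i = j then 1 else 0)"
    and ker: "\<And>x. (\<And>i. i \<in> J \<Longrightarrow> v i x = 0) \<Longrightarrow> blinfun_apply g x = 0"
  shows "g = (\<Sum>j\<in>J. g (e j) *\<^sub>R v j)"
proof (rule blinfun_eqI)
  fix x
  have "g (x - (\<Sum>j\<in>J. v j x *\<^sub>R e j)) = 0"
  proof (rule ker)
    fix i assume "i \<in> J"
    then have "(\<Sum>j\<in>J. v j x * v i (e j)) = (\<Sum>j\<in>J. if i = j then v j x else 0)"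
      by (intro sum.cong) (auto simp: bi)
    then show "v i (x - (\<Sum>j\<in>J. v j x *\<^sub>R e j)) = 0"
      using \<open>finite J\<close> \<open>i \<in> J\<close>
      by (simp add: blinfun.diff_right blinfun.sum_right blinfun.scaleR_right)
  qed
  then show "g x = (\<Sum>j\<in>J. g (e j) *\<^sub>R v j) x"
    by (simp add: blinfun.diff_right blinfun.sum_right blinfun.scaleR_right blinfun.sum_left
        blinfun.scaleR_left mult.commute)
qed

text \<open>
  Induction on \<open>J\<close>: if \<open>v k\<close> vanished on the common kernel of the other functionals it would be a
  combination of them. So some \<open>x\<close> in that kernel has \<open>v k x = 1\<close>; it serves as the new vector, and
  subtracting multiples of it from the old vectors makes \<open>v k\<close> vanish on them.
\<close>

lemma exists_biorthogonal_vectors: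
  fixes v :: "'i \<Rightarrow> ('a::real_normed_vector \<Rightarrow>\<^sub>L real)"
  assumes "finite J" and "linearly_independent_family v J"
  shows "\<exists>e. \<forall>i\<in>J. \<forall>j\<in>J. v i (e j) = (if i = j then 1 else 0)"
  using assms
proof (induction J)
  case empty
  then show ?case by simp
next
  case (insert k J)
  have "linearly_independent_family v J"
    using insert.prems unfolding linearly_independent_family_def by blast
  with insert.IH obtain e where
    e: "\<And>i j. i \<in> J \<Longrightarrow> j \<in> J \<Longrightarrow> v i (e j) = (if i = j then 1 else 0)"
    by blast
  have "\<exists>y. (\<forall>i\<in>J. v i y = 0) \<and> v k y \<noteq> 0"
  proof (rule ccontr)
    assume "\<not> ?thesis"
    then have comb: "v k = (\<Sum>j\<in>J. v k (e j) *\<^sub>R v j)"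
      using \<open>finite J\<close> e by (intro vanishing_on_common_kernel_imp_combination) auto
    define c where "c j = (if j = k then -1 else v k (e j))" for j
    have "(\<Sum>j\<in>J. c j *\<^sub>R v j) = (\<Sum>j\<in>J. v k (e j) *\<^sub>R v j)"
      using \<open>k \<notin> J\<close> by (intro sum.cong) (auto simp: c_def)
    then have "(\<Sum>j\<in>insert k J. c j *\<^sub>R v j) = 0"
      using insert.hyps comb by (simp add: c_def)
    moreover have "finite (insert k J)"
      using insert.hyps by simp
    ultimately have "c k = 0"
      using insert.prems unfolding linearly_independent_family_def by blast
    then show False by (simp add: c_def)
  qed
  then obtain y where y: "\<And>i. i \<in> J \<Longrightarrow> v i y = 0" "v k y \<noteq> 0"
    by blast
  define x where "x = y /\<^sub>R v k y"
  have x: "v i x = 0" if "i \<in> J" for i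
    using y that by (simp add: x_def blinfun.scaleR_right)
  have xk: "v k x = 1"
    using y by (simp add: x_def blinfun.scaleR_right)
  define e' where "e' j = (if j = k then x else e j - v k (e j) *\<^sub>R x)" for j
  have "v i (e' j) = (if i = j then 1 else 0)" if "i \<in> insert k J" "j \<in> insert k J" for i j
    using that x xk e \<open>k \<notin> J\<close>
    by (auto simp: e'_def blinfun.diff_right blinfun.scaleR_right)
  then show ?case by blast
qed

section \<open>Points with exact linearized constraint values\<close>

lemma eventually_at_right_0_obtain:
  fixes P :: "real \<Rightarrow> bool"
  assumes "\<forall>\<^sub>F \<delta> in at_right 0. P \<delta>"
  obtains \<delta> where "0 < \<delta>" "P \<delta>"
  using eventually_happens'[OF trivial_limit_at_right_real
      eventually_conj[OF eventually_at_right_less assms]] by blast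

text \<open>
  The mean value inequality applied to \<open>f - f'(x)\<close>, whose derivative is small near \<open>x\<close> because the
  derivative of \<open>f\<close> is continuous. Phrasing the radius through a filter lets finitely many functions
  share one radius.
\<close>

lemma linearization_error_Lipschitz:
  fixes f :: "'a::real_normed_vector \<Rightarrow> real"
  assumes "open S" "x \<in> S" "continuously_differentiable_on f S" "0 < \<eta>"
  shows "\<forall>\<^sub>F \<delta> in at_right 0. \<forall>y\<in>ball x \<delta>. \<forall>z\<in>ball x \<delta>.
           \<bar>(f y - fderiv f x y) - (f z - fderiv f x z)\<bar> \<le> \<eta> * norm (y - z)"
proof -
  have "continuous_on S (fderiv f)"
    using assms(3) by (simp add: continuously_differentiable_on_def)
  then have "isCont (fderiv f) x"
    using assms(1,2) by (simp add: continuous_on_eq_continuous_at)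
  then have "\<forall>\<^sub>F y in nhds x. dist (fderiv f y) (fderiv f x) < \<eta>"
    using \<open>0 < \<eta>\<close> by (simp add: isCont_def tendsto_at_iff_tendsto_nhds tendstoD)
  moreover have "\<forall>\<^sub>F y in nhds x. y \<in> S"
    using assms(1,2) by (rule eventually_nhds_in_open)
  ultimately have "\<forall>\<^sub>F y in nhds x. dist (fderiv f y) (fderiv f x) < \<eta> \<and> y \<in> S"
    by (rule eventually_conj)
  then obtain d where d: "0 < d"
    and near: "\<And>y. dist y x < d \<Longrightarrow> dist (fderiv f y) (fderiv f x) < \<eta> \<and> y \<in> S"
    unfolding eventually_nhds_metric by blast
  have "\<bar>(f y - fderiv f x y) - (f z - fderiv f x z)\<bar> \<le> \<eta> * norm (y - z)"
    if "\<delta> < d" "y \<in> ball x \<delta>" "z \<in> ball x \<delta>" for \<delta> y z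
  proof -
    have "norm ((f y - fderiv f x y) - (f z - fderiv f x z)) \<le> \<eta> * norm (y - z)"
    proof (rule differentiable_bound[of "ball x \<delta>" _ "\<lambda>w. blinfun_apply (fderiv f w - fderiv f x)"])
      fix w assume "w \<in> ball x \<delta>"
      then have w: "dist (fderiv f w) (fderiv f x) < \<eta>" "w \<in> S"
        using near[of w] \<open>\<delta> < d\<close> by (auto simp: dist_commute)
      have "(f has_derivative fderiv f w) (at w)"
        using assms(3) w by (intro fderiv_works) (simp add: continuously_differentiable_on_def)
      then have "((\<lambda>w. f w - fderiv f x w) has_derivative (\<lambda>h. fderiv f w h - fderiv f x h))
          (at w within ball x \<delta>)"
        by (intro has_derivative_diff blinfun.bounded_linear_right bounded_linear_imp_has_derivative)
          (rule has_derivative_at_withinI)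
      then show "((\<lambda>w. f w - fderiv f x w) has_derivative blinfun_apply (fderiv f w - fderiv f x))
          (at w within ball x \<delta>)"
        by (simp add: blinfun.diff_left[abs_def] fun_diff_def)
      show "onorm (blinfun_apply (fderiv f w - fderiv f x)) \<le> \<eta>"
        using w by (simp add: dist_norm norm_blinfun.rep_eq)
    qed (use that in auto)
    then show ?thesis by simp
  qed
  then show ?thesis
    using d unfolding eventually_at_right_field by blast
qed

text \<open>
  Let \<open>L i\<close> be the derivative and \<open>r i = f i - L i\<close> the linearization error. Seek the point as
  \<open>y = x + t h + (\<Sum>j\<in>J. \<psi> (e j) * e j)\<close> with a functional \<open>\<psi>\<close>. By biorthogonality
  \<open>f i y = f i x + t * L i h\<close> holds if \<open>\<psi> (e i) = r i x - r i y\<close> for all \<open>i\<close> in \<open>J\<close>, and therefore if \<open>\<psi>\<close> is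
  a fixed point of \<open>\<psi> \<mapsto> (\<Sum>i\<in>J. (r i x - r i y) * L i)\<close>. That map is a contraction, since the \<open>r i\<close> have
  arbitrarily small Lipschitz constants near \<open>x\<close>, and the dual space is complete even if the space
  itself is not. Holding the unknown coordinates in a functional also avoids a type of dimension
  \<open>card J\<close>.
\<close>

lemma exact_linearized_values:
  fixes f :: "'i \<Rightarrow> 'a::real_normed_vector \<Rightarrow> real"
  assumes "open S" "x \<in> S" "finite J"
    and C1: "\<And>i. i \<in> J \<Longrightarrow> continuously_differentiable_on (f i) S"
    and bi: "\<And>i j. i \<in> J \<Longrightarrow> j \<in> J \<Longrightarrow> fderiv (f i) x (e j) = (if i = j then 1 else 0)"
    and "0 < \<epsilon>"
  shows "\<forall>\<^sub>F t in at_right 0. \<exists>y. norm (y - (x + t *\<^sub>R h)) \<le> \<epsilon> * t \<and>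
           (\<forall>i\<in>J. f i y = f i x + t * fderiv (f i) x h)"
proof -
  define L where "L i = fderiv (f i) x" for i
  define r where "r i y = f i y - L i y" for i y
  define w where "w \<psi> = (\<Sum>j\<in>J. \<psi> (e j) *\<^sub>R e j)" for \<psi> :: "'a \<Rightarrow>\<^sub>L real"
  define K where "K = (\<Sum>j\<in>J. norm (e j) * norm (e j))"
  define \<Lambda> where "\<Lambda> = (\<Sum>i\<in>J. norm (L i))"
  have K: "0 \<le> K" and \<Lambda>: "0 \<le> \<Lambda>"
    by (simp_all add: K_def \<Lambda>_def sum_nonneg)
  have w_diff: "w \<psi> - w \<phi> = w (\<psi> - \<phi>)" for \<psi> \<phi>
    by (simp add: w_def sum_subtractf scaleR_diff_left blinfun.diff_left)
  have w_le: "norm (w \<psi>) \<le> K * norm \<psi>" for \<psi>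
  proof -
    have "norm (w \<psi>) \<le> (\<Sum>j\<in>J. norm (\<psi> (e j) *\<^sub>R e j))"
      unfolding w_def by (rule norm_sum)
    also have "\<dots> \<le> (\<Sum>j\<in>J. (norm \<psi> * norm (e j)) * norm (e j))"
      unfolding norm_scaleR real_norm_def[symmetric]
      by (intro sum_mono mult_right_mono norm_blinfun norm_ge_zero)
    finally show ?thesis
      by (simp add: K_def sum_distrib_left mult_ac)
  qed
  \<comment> \<open>Functionals of norm at most \<open>\<rho> t\<close> give corrections of norm at most \<open>\<epsilon> t\<close>. The errors \<open>r i\<close>
    have Lipschitz constant \<open>\<eta>\<close>, so the map has Lipschitz constant \<open>\<kappa>\<close> in terms of the point; \<open>\<kappa>\<close> is
    chosen to preserve the ball of radius \<open>\<rho> t\<close> and to make the contraction factor \<open>\<kappa> K\<close> at most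
    one half.\<close>
  define \<rho> where "\<rho> = \<epsilon> / (K + 1)"
  define \<kappa> where "\<kappa> = \<rho> / (norm h + 2 * \<epsilon>)"
  define \<eta> where "\<eta> = \<kappa> / (\<Lambda> + 1)"
  have \<rho>: "0 < \<rho>" "K * \<rho> \<le> \<epsilon>"
    using K \<open>0 < \<epsilon>\<close> by (auto simp: \<rho>_def field_simps)
  have pos: "0 < norm h + 2 * \<epsilon>"
    using \<open>0 < \<epsilon>\<close> by (simp add: add_nonneg_pos)
  have \<kappa>: "0 < \<kappa>"
    using \<rho> pos by (simp add: \<kappa>_def)
  have \<kappa>_self: "\<kappa> * (norm h + \<epsilon>) \<le> \<rho>"
  proof -
    have "\<kappa> * (norm h + \<epsilon>) \<le> \<kappa> * (norm h + 2 * \<epsilon>)"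
      using \<kappa> \<open>0 < \<epsilon>\<close> by (intro mult_left_mono) auto
    also have "\<dots> = \<rho>"
      using pos by (simp add: \<kappa>_def)
    finally show ?thesis .
  qed
  have \<kappa>_contr: "\<kappa> * K \<le> 1 / 2"
  proof -
    have "2 * (K * \<rho>) \<le> norm h + 2 * \<epsilon>"
      using \<rho>(2) norm_ge_zero[of h] by linarith
    then show ?thesis
      using pos by (simp add: \<kappa>_def pos_divide_le_eq mult.commute)
  qed
  have \<eta>: "0 < \<eta>" "\<eta> * \<Lambda> \<le> \<kappa>"
    using \<kappa> \<Lambda> by (auto simp: \<eta>_def field_simps)
  have "\<forall>\<^sub>F \<delta> in at_right 0. \<forall>i\<in>J. \<forall>y\<in>ball x \<delta>. \<forall>z\<in>ball x \<delta>.
      \<bar>r i y - r i z\<bar> \<le> \<eta> * norm (y - z)"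
    unfolding r_def L_def
    using assms(1-3) C1 \<eta>(1) by (intro eventually_ball_finite ballI linearization_error_Lipschitz)
  then obtain \<delta> where \<delta>: "0 < \<delta>"
    and lip: "\<And>i y z. i \<in> J \<Longrightarrow> y \<in> ball x \<delta> \<Longrightarrow> z \<in> ball x \<delta> \<Longrightarrow> \<bar>r i y - r i z\<bar> \<le> \<eta> * norm (y - z)"
    by (rule eventually_at_right_0_obtain) blast
  have "\<exists>y. norm (y - (x + t *\<^sub>R h)) \<le> \<epsilon> * t \<and> (\<forall>i\<in>J. f i y = f i x + t * L i h)"
    if t: "0 < t" "t < \<delta> / (norm h + 2 * \<epsilon>)" for t
  proof -
    define y where "y \<psi> = x + t *\<^sub>R h + w \<psi>" for \<psi>
    define F where "F \<psi> = (\<Sum>i\<in>J. (r i x - r i (y \<psi>)) *\<^sub>R L i)" for \<psi>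
    define B where "B = cball (0 :: 'a \<Rightarrow>\<^sub>L real) (\<rho> * t)"
    have w_small: "norm (w \<psi>) \<le> \<epsilon> * t" if "\<psi> \<in> B" for \<psi>
    proof -
      have "norm (w \<psi>) \<le> K * norm \<psi>"
        by (rule w_le)
      also have "\<dots> \<le> K * (\<rho> * t)"
        using that K by (intro mult_left_mono) (auto simp: B_def)
      also have "\<dots> \<le> \<epsilon> * t"
        unfolding mult.assoc[symmetric] using \<rho>(2) t by (intro mult_right_mono) auto
      finally show ?thesis .
    qed
    have y_near: "norm (x - y \<psi>) \<le> (norm h + \<epsilon>) * t" if "\<psi> \<in> B" for \<psi>
    proof -
      have "x - y \<psi> = - (t *\<^sub>R h + w \<psi>)"
        by (simp add: y_def)
      then have "norm (x - y \<psi>) = norm (t *\<^sub>R h + w \<psi>)"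
        by (simp only: norm_minus_cancel)
      also have "\<dots> \<le> t * norm h + \<epsilon> * t"
        using w_small[OF that] t norm_triangle_ineq[of "t *\<^sub>R h" "w \<psi>"] by simp
      finally show ?thesis
        by (simp add: algebra_simps)
    qed
    have "(norm h + \<epsilon>) * t \<le> (norm h + 2 * \<epsilon>) * t"
      using t \<open>0 < \<epsilon>\<close> by (intro mult_right_mono) auto
    also have "\<dots> < \<delta>"
      using t(2) pos by (simp add: pos_less_divide_eq mult.commute)
    finally have y_in: "y \<psi> \<in> ball x \<delta>" if "\<psi> \<in> B" for \<psi>
      using y_near[OF that] by (simp add: dist_norm)
    have F_le: "norm (\<Sum>i\<in>J. (r i p - r i q) *\<^sub>R L i) \<le> \<kappa> * norm (p - q)"
      if "p \<in> ball x \<delta>" "q \<in> ball x \<delta>" for p q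
    proof -
      have "norm (\<Sum>i\<in>J. (r i p - r i q) *\<^sub>R L i) \<le> (\<Sum>i\<in>J. \<eta> * norm (p - q) * norm (L i))"
        using lip that by (intro sum_norm_le) (simp add: mult_right_mono)
      also have "\<dots> = (\<eta> * \<Lambda>) * norm (p - q)"
        by (simp add: \<Lambda>_def sum_distrib_left mult_ac)
      also have "\<dots> \<le> \<kappa> * norm (p - q)"
        using \<eta>(2) by (intro mult_right_mono) auto
      finally show ?thesis .
    qed
    have "\<exists>!\<psi>. \<psi> \<in> B \<and> F \<psi> = \<psi>"
    proof (rule Banach_fix[of B "1 / 2" F])
      show "complete B"
        by (simp add: B_def complete_eq_closed)
      show "B \<noteq> {}"
        using mult_pos_pos[OF \<rho>(1) t(1)] by (simp add: B_def)
      show "F ` B \<subseteq> B"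
      proof (rule image_subsetI)
        fix \<psi> assume \<psi>: "\<psi> \<in> B"
        have "norm (F \<psi>) \<le> \<kappa> * norm (x - y \<psi>)"
          unfolding F_def using \<delta> y_in[OF \<psi>] by (intro F_le) auto
        also have "\<dots> \<le> \<kappa> * ((norm h + \<epsilon>) * t)"
          using y_near[OF \<psi>] \<kappa> by (intro mult_left_mono) auto
        also have "\<dots> \<le> \<rho> * t"
          unfolding mult.assoc[symmetric] using \<kappa>_self t by (intro mult_right_mono) auto
        finally show "F \<psi> \<in> B"
          by (simp add: B_def)
      qed
      fix \<psi> \<phi> assume B: "\<psi> \<in> B" "\<phi> \<in> B"
      have "F \<psi> - F \<phi> = (\<Sum>i\<in>J. (r i (y \<phi>) - r i (y \<psi>)) *\<^sub>R L i)"
        unfolding F_def sum_subtractf[symmetric] scaleR_diff_left[symmetric] by simp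
      then have "norm (F \<psi> - F \<phi>) \<le> \<kappa> * norm (y \<phi> - y \<psi>)"
        using F_le[of "y \<phi>" "y \<psi>"] y_in B by simp
      also have "y \<phi> - y \<psi> = w (\<phi> - \<psi>)"
        by (simp add: y_def w_diff)
      also have "\<kappa> * norm (w (\<phi> - \<psi>)) \<le> \<kappa> * (K * norm (\<phi> - \<psi>))"
        using w_le \<kappa> by (intro mult_left_mono) auto
      also have "\<dots> \<le> 1 / 2 * norm (\<phi> - \<psi>)"
        unfolding mult.assoc[symmetric] using \<kappa>_contr by (intro mult_right_mono) auto
      finally show "dist (F \<psi>) (F \<phi>) \<le> 1 / 2 * dist \<psi> \<phi>"
        by (simp add: dist_norm norm_minus_commute)
    qed simp_all
    then obtain \<psi> where \<psi>: "\<psi> \<in> B" "F \<psi> = \<psi>"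
      by blast
    have "f i (y \<psi>) = f i x + t * L i h" if i: "i \<in> J" for i
    proof -
      have "\<psi> (e i) = (\<Sum>j\<in>J. (r j x - r j (y \<psi>)) * L j (e i))"
        using arg_cong[OF \<psi>(2), of "\<lambda>\<phi>. blinfun_apply \<phi> (e i)"]
        by (simp add: F_def blinfun.sum_left blinfun.scaleR_left)
      also have "\<dots> = (\<Sum>j\<in>J. if j = i then r j x - r j (y \<psi>) else 0)"
        using bi i by (intro sum.cong) (auto simp: L_def)
      also have "\<dots> = r i x - r i (y \<psi>)"
        using \<open>finite J\<close> i by simp
      finally have \<psi>i: "\<psi> (e i) = r i x - r i (y \<psi>)" .
      have "L i (w \<psi>) = (\<Sum>j\<in>J. if i = j then \<psi> (e j) else 0)"
        unfolding w_def blinfun.sum_right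
        using bi i by (intro sum.cong) (auto simp: blinfun.scaleR_right L_def)
      also have "\<dots> = \<psi> (e i)"
        using \<open>finite J\<close> i by simp
      finally have "L i (y \<psi>) = L i x + t * L i h + \<psi> (e i)"
        by (simp add: y_def blinfun.add_right blinfun.scaleR_right)
      with \<psi>i show ?thesis
        by (simp add: r_def)
    qed
    moreover have "norm (y \<psi> - (x + t *\<^sub>R h)) \<le> \<epsilon> * t"
      using w_small[OF \<psi>(1)] by (simp add: y_def)
    ultimately show ?thesis
      by blast
  qed
  moreover have "0 < \<delta> / (norm h + 2 * \<epsilon>)"
    using \<delta> pos by simp
  ultimately show ?thesis
    unfolding eventually_at_right_field L_def by blast
qed

section \<open>The first-order condition\<close>

text \<open>
  If the derivative of \<open>f 0\<close> along \<open>h\<close> were negative, the points of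
  \<open>exact_linearized_values\<close> would be feasible for small \<open>t\<close> and, lying within \<open>\<epsilon> t\<close> of \<open>x + t h\<close>, would have a smaller objective value than \<open>x\<close>.
\<close>

lemma derivative_nonneg_on_feasible_directions:
  fixes f :: "nat \<Rightarrow> 'a::real_normed_vector \<Rightarrow> real"
  assumes "open \<Omega>"
    and C1: "\<And>i. i \<le> n + m \<Longrightarrow> continuously_differentiable_on (f i) \<Omega>"
    and sol: "is_solution \<Omega> f n m x"
    and bi: "\<And>i j. i \<in> active_set f n m x \<Longrightarrow> j \<in> active_set f n m x \<Longrightarrow>
        fderiv (f i) x (e j) = (if i = j then 1 else 0)"
    and eq: "\<And>i. i \<in> {1..n} \<Longrightarrow> fderiv (f i) x h = 0"
    and ineq: "\<And>i. i \<in> active_set f n m x \<Longrightarrow> fderiv (f i) x h \<le> 0"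
  shows "0 \<le> fderiv (f 0) x h"
proof (rule ccontr)
  define J where "J = active_set f n m x"
  define L where "L = fderiv (f 0) x"
  assume "\<not> 0 \<le> fderiv (f 0) x h"
  then have neg: "0 < - L h"
    by (simp add: L_def)
  have x: "x \<in> \<Omega>" and feas: "\<And>i. i \<in> {1..n} \<Longrightarrow> f i x = 0" "\<And>i. i \<in> {n+1..n+m} \<Longrightarrow> f i x \<le> 0"
    using sol by (auto simp: is_solution_def feasible_set_def)
  have finJ: "finite J"
    by (rule finite_subset[of _ "{..n+m}"]) (auto simp: J_def active_set_def)
  \<comment> \<open>The two error terms \<open>L (y - x - t h)\<close> and \<open>\<eta> * norm (y - x)\<close> each use up at most a quarter
    of the decrease \<open>- t * L h\<close>.\<close>
  define \<epsilon> where "\<epsilon> = - L h / (4 * (norm L + 1))"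
  define \<eta> where "\<eta> = - L h / (4 * (norm h + \<epsilon>))"
  have \<epsilon>: "0 < \<epsilon>"
    unfolding \<epsilon>_def using neg by (intro divide_pos_pos mult_pos_pos add_nonneg_pos) auto
  have \<eta>: "0 < \<eta>"
    unfolding \<eta>_def using neg \<epsilon> by (intro divide_pos_pos mult_pos_pos add_nonneg_pos) auto
  have "norm L + 1 \<noteq> 0" "norm h + \<epsilon> \<noteq> 0"
    using \<epsilon> norm_ge_zero[of L] norm_ge_zero[of h] by linarith+
  then have e1: "4 * (\<epsilon> * (norm L + 1)) = - L h" and q2: "4 * (\<eta> * (norm h + \<epsilon>)) = - L h"
    unfolding \<eta>_def by (simp add: \<epsilon>_def divide_simps, simp add: divide_simps)
  have q1: "4 * (norm L * \<epsilon>) \<le> - L h"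
    using e1 \<epsilon> by (simp add: algebra_simps)
  have "\<forall>\<^sub>F \<delta> in at_right 0. \<forall>y\<in>ball x \<delta>. \<forall>z\<in>ball x \<delta>.
      \<bar>(f 0 y - L y) - (f 0 z - L z)\<bar> \<le> \<eta> * norm (y - z)"
    unfolding L_def using assms(1) x C1 \<eta> by (intro linearization_error_Lipschitz) auto
  then obtain \<delta> where \<delta>: "0 < \<delta>"
    and lip: "\<And>y z. y \<in> ball x \<delta> \<Longrightarrow> z \<in> ball x \<delta> \<Longrightarrow>
      \<bar>(f 0 y - L y) - (f 0 z - L z)\<bar> \<le> \<eta> * norm (y - z)"
    by (rule eventually_at_right_0_obtain) blast
  have stay: "\<forall>\<^sub>F y in nhds x. f i y < 0" if "i \<in> {n+1..n+m} - J" for i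
  proof -
    have "f i differentiable (at x)"
      using C1[of i] that x by (simp add: continuously_differentiable_on_def)
    then have "isCont (f i) x"
      by (rule differentiable_imp_continuous_within)
    moreover have "f i x < 0"
      using feas(2)[of i] that by (auto simp: J_def active_set_def)
    ultimately show ?thesis
      by (simp add: isCont_def tendsto_at_iff_tendsto_nhds order_tendstoD(2))
  qed
  have "\<forall>\<^sub>F y in nhds x. \<forall>i\<in>{n+1..n+m} - J. f i y < 0"
    using stay by (intro eventually_ball_finite) auto
  moreover have "\<forall>\<^sub>F y in nhds x. y \<in> \<Omega>"
    using assms(1) x by (rule eventually_nhds_in_open)
  ultimately have "\<forall>\<^sub>F y in nhds x. (\<forall>i\<in>{n+1..n+m} - J. f i y < 0) \<and> y \<in> \<Omega>"
    by (rule eventually_conj)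
  then obtain \<delta>' where \<delta>': "0 < \<delta>'"
    and near: "\<And>y. dist y x < \<delta>' \<Longrightarrow> (\<forall>i\<in>{n+1..n+m} - J. f i y < 0) \<and> y \<in> \<Omega>"
    unfolding eventually_nhds_metric by blast
  have "\<forall>\<^sub>F t in at_right 0. \<exists>y. norm (y - (x + t *\<^sub>R h)) \<le> \<epsilon> * t \<and>
      (\<forall>i\<in>J. f i y = f i x + t * fderiv (f i) x h)"
  proof (rule exact_linearized_values[where e = e, OF assms(1) x finJ _ _ \<epsilon>])
    show "continuously_differentiable_on (f i) \<Omega>" if "i \<in> J" for i
      using C1 that by (simp add: J_def active_set_def)
  qed (use bi in \<open>simp add: J_def\<close>)
  moreover have "((\<lambda>t. (norm h + \<epsilon>) * t) \<longlongrightarrow> (norm h + \<epsilon>) * 0) (at_right 0)"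
    by (intro tendsto_intros)
  then have "\<forall>\<^sub>F t in at_right 0. (norm h + \<epsilon>) * t < min \<delta> \<delta>'"
    using \<delta> \<delta>' by (intro order_tendstoD(2)) auto
  ultimately have "\<forall>\<^sub>F t in at_right 0. (norm h + \<epsilon>) * t < min \<delta> \<delta>' \<and>
      (\<exists>y. norm (y - (x + t *\<^sub>R h)) \<le> \<epsilon> * t \<and> (\<forall>i\<in>J. f i y = f i x + t * fderiv (f i) x h))"
    by eventually_elim auto
  then obtain t y where t: "0 < t" "(norm h + \<epsilon>) * t < min \<delta> \<delta>'"
    and y: "norm (y - (x + t *\<^sub>R h)) \<le> \<epsilon> * t" "\<And>i. i \<in> J \<Longrightarrow> f i y = f i x + t * fderiv (f i) x h"
    by (rule eventually_at_right_0_obtain) blast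
  define w where "w = y - (x + t *\<^sub>R h)"
  have yx: "y - x = t *\<^sub>R h + w"
    by (simp add: w_def)
  have dist_y: "norm (y - x) \<le> (norm h + \<epsilon>) * t"
    using norm_triangle_ineq[of "t *\<^sub>R h" w] y(1) t
    by (simp add: yx flip: w_def) (simp add: algebra_simps)
  have close: "dist y x < \<delta>" "dist y x < \<delta>'"
    using dist_y t by (auto simp: dist_norm)
  have "y \<in> feasible_set \<Omega> f n m"
    unfolding feasible_set_def
  proof (intro CollectI conjI ballI)
    show "y \<in> \<Omega>"
      using near close by blast
  next
    fix i assume i: "i \<in> {1..n}"
    then have "i \<in> J"
      using feas(1) by (simp add: J_def active_set_def)
    then show "f i y = 0"
      using y(2) feas(1) eq i by simp
  next
    fix i assume i: "i \<in> {n+1..n+m}"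
    show "f i y \<le> 0"
    proof (cases "i \<in> J")
      case True
      then have "f i y = t * fderiv (f i) x h"
        using y(2) by (simp add: J_def active_set_def)
      then show ?thesis
        using ineq[of i] True t by (simp add: J_def mult_nonneg_nonpos)
    next
      case False
      then show ?thesis
        using near[of y] close i by (meson DiffI less_imp_le)
    qed
  qed
  then have "f 0 x \<le> f 0 y"
    using sol by (simp add: is_solution_def)
  moreover have "f 0 y < f 0 x"
  proof -
    have "\<bar>(f 0 y - L y) - (f 0 x - L x)\<bar> \<le> \<eta> * norm (y - x)"
      using close \<delta> by (intro lip) (auto simp: dist_commute)
    also have "\<dots> \<le> \<eta> * ((norm h + \<epsilon>) * t)"
      using dist_y \<eta> by (intro mult_left_mono) auto
    also have "4 * \<dots> = - L h * t"
      unfolding q2[symmetric] by simp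
    finally have "4 * \<bar>(f 0 y - L y) - (f 0 x - L x)\<bar> \<le> - L h * t"
      by simp
    then have err: "4 * ((f 0 y - L y) - (f 0 x - L x)) \<le> - (L h * t)"
      using abs_ge_self[of "(f 0 y - L y) - (f 0 x - L x)"] by simp
    have "L w \<le> norm L * norm w"
      using norm_blinfun[of L w] by simp
    also have "\<dots> \<le> norm L * (\<epsilon> * t)"
      using y(1) by (intro mult_left_mono) (auto simp: w_def)
    finally have "4 * L w \<le> 4 * (norm L * \<epsilon>) * t"
      by simp
    also have "\<dots> \<le> - L h * t"
      using q1 t by (intro mult_right_mono) auto
    finally have Lw: "4 * L w \<le> - (L h * t)"
      by simp
    have "L y - L x = L h * t + L w"
      unfolding blinfun.diff_right[symmetric] yx
      by (simp add: blinfun.add_right blinfun.scaleR_right)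
    moreover have "0 < - (L h * t)"
      using neg t by (simp add: mult_neg_pos)
    ultimately show ?thesis
      using err Lw unfolding right_diff_distrib by linarith
  qed
  ultimately show False
    by simp
qed

theorem theorem1p1:
  fixes \<Omega> :: "'a::real_normed_vector set"
    and f :: "nat \<Rightarrow> 'a \<Rightarrow> real"
    and n m :: nat
    and xs :: 'a
  assumes "open \<Omega>"
    and "n \<ge> 1"
    and "\<And>i. i \<le> n + m \<Longrightarrow> continuously_differentiable_on (f i) \<Omega>"
    and "is_solution \<Omega> f n m xs"
    and "linearly_independent_family (\<lambda>i. fderiv (f i) xs) (active_set f n m xs)"
  shows "\<exists>l \<mu> :: nat \<Rightarrow> real.
           (\<forall>j\<in>{1..m}. 0 \<le> \<mu> j) \<and>
           fderiv (f 0) xs + (\<Sum>i=1..n. l i *\<^sub>R fderiv (f i) xs)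
             + (\<Sum>j=1..m. \<mu> j *\<^sub>R fderiv (f (j + n)) xs) = 0 \<and>
           (\<forall>j\<in>{1..m}. \<mu> j * f (j + n) xs = 0)"
proof -
  define J where "J = active_set f n m xs"
  define D where "D i = fderiv (f i) xs" for i
  have finJ: "finite J"
    by (rule finite_subset[of _ "{..n+m}"]) (auto simp: J_def active_set_def)
  have JI: "{1..n} \<subseteq> J"
    using assms(4) by (auto simp: J_def active_set_def is_solution_def feasible_set_def)
  obtain e where e: "\<And>i j. i \<in> J \<Longrightarrow> j \<in> J \<Longrightarrow> D i (e j) = (if i = j then 1 else 0)"
    using exists_biorthogonal_vectors[OF finJ] assms(5) unfolding J_def D_def by blast
  have nonneg: "0 \<le> D 0 h" if "\<And>i. i \<in> {1..n} \<Longrightarrow> D i h = 0" "\<And>i. i \<in> J \<Longrightarrow> D i h \<le> 0" for h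
    using derivative_nonneg_on_feasible_directions[OF assms(1,3,4), of e h] that e
    by (simp add: J_def D_def)
  define c where "c j = (if j \<in> J then - D 0 (e j) else 0)" for j
  have "D 0 = (\<Sum>j\<in>J. D 0 (e j) *\<^sub>R D j)"
  proof (rule vanishing_on_common_kernel_imp_combination[OF finJ e])
    fix h assume h: "\<And>i. i \<in> J \<Longrightarrow> D i h = 0"
    then have "0 \<le> D 0 h" "0 \<le> D 0 (- h)"
      using JI by (intro nonneg; auto simp: blinfun.minus_right)+
    then show "D 0 h = 0"
      by (simp add: blinfun.minus_right)
  qed
  then have "D 0 + (\<Sum>j\<in>J. c j *\<^sub>R D j) = 0"
    by (simp add: c_def sum_negf)
  moreover have "(\<Sum>j\<in>J. c j *\<^sub>R D j) = (\<Sum>j\<in>{1..n+m}. c j *\<^sub>R D j)"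
    by (rule sum.mono_neutral_left) (auto simp: c_def J_def active_set_def)
  moreover have "\<dots> = (\<Sum>i=1..n. c i *\<^sub>R D i) + (\<Sum>i=1+n..m+n. c i *\<^sub>R D i)"
    by (subst sum.ub_add_nat) (simp_all add: add.commute)
  moreover have "(\<Sum>i=1+n..m+n. c i *\<^sub>R D i) = (\<Sum>j=1..m. c (j + n) *\<^sub>R D (j + n))"
    by (rule sum.shift_bounds_cl_nat_ivl)
  ultimately have "D 0 + (\<Sum>i=1..n. c i *\<^sub>R D i) + (\<Sum>j=1..m. c (j + n) *\<^sub>R D (j + n)) = 0"
    by (simp add: add.assoc)
  moreover have "0 \<le> c (j + n)" if j: "j \<in> {1..m}" for j
  proof (cases "j + n \<in> J")
    case True
    have "0 \<le> D 0 (- e (j + n))"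
      using True JI j e[OF _ True] by (intro nonneg) (auto simp: blinfun.minus_right)
    then show ?thesis
      using True by (simp add: c_def blinfun.minus_right)
  qed (simp add: c_def)
  moreover have "c (j + n) * f (j + n) xs = 0" for j
    by (simp add: c_def J_def active_set_def)
  ultimately show ?thesis
    unfolding D_def by (intro exI[of _ c] exI[of _ "\<lambda>j. c (j + n)"]) blast
qed

end
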